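(* Let $f:\mathbb{R}\to\mathbb{R}$ be a map and $p$ a fixed point of $f$ such that, for some $\delta>0$, $f$ is Lipschitz with constant $C\neq1$ in the neighborhood $N_\delta(p)$. Assume that $$\bigl|(1-C)^{-1}[f(x)-f(y)-C(x-y)]\bigr|\le\tfrac13|x-y|\quad\text{for all }x,y\in N_\delta(p).$$ Then for all sufficiently small $\varepsilon>0$ the following holds: if $g:\mathbb{R}\to\mathbb{R}$ is a locally Lipschitz map with $\|f-g\|_{N_\delta(p)}<\varepsilon$, then there is a unique fixed point $q$ of $g$ in $N_\delta(p)$. Moreover, if $C<1$ then $q$ is a sink for $g$, and if $f$ is reverse Lipschitz in $N_\delta(p)$ with constant $r>1$ then $q$ is a source for $g$.
   Context: $N_\delta(p)=(p-\delta,p+\delta)$. $f$ is Lipschitz with constant $C$ in $N$ if $|f(x)-f(y)|\le C|x-y|$ for all $x,y\in N$, and reverse Lipschitz with constant $r>0$ in $N$ if $|f(x)-f(y)|\ge r|x-y|$ for all $x,y\in N$. For a function $u$ that is Lipschitz on $N=N_\delta(p)$, $\|u\|_{N}=\max\{\sup_{x\in \overline{N}}|u(x)|,\ \mathrm{Lip}(u,N)\}$, where $\mathrm{Lip}(u,N)=\sup\{|u(x)-u(y)|/|x-y|:x,y\in N,\ x\neq y\}$. A fixed point $q$ of $g$ is a sink if there is $\epsilon>0$ such that $\lim_{k\to\infty}g^k(x)=q$ for all $x\in N_\epsilon(q)$; it is a source if there is $\epsilon>0$ such that for every $x\in N_\epsilon(q)$, $x\neq q$, there is a positive integer $k$ with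 $|g^k(x)-q|\ge\epsilon$. *)

theory Defs
  imports "HOL-Analysis.Analysis"
begin

abbreviation nbhd :: "real \<Rightarrow> real \<Rightarrow> real set" where
  "nbhd \<delta> p \<equiv> {p - \<delta><..<p + \<delta>}"

definition reverse_lipschitz_on :: "real \<Rightarrow> real set \<Rightarrow> (real \<Rightarrow> real) \<Rightarrow> bool" where
  "reverse_lipschitz_on r N f \<longleftrightarrow> 0 < r \<and> (\<forall>x\<in>N. \<forall>y\<in>N. \<bar>f x - f y\<bar> \<ge> r * \<bar>x - y\<bar>)"

(* local_lipschitz is a notion for families indexed by a parameter; for a single map the
   family is constant. *)
definition locally_lipschitz :: "(real \<Rightarrow> real) \<Rightarrow> bool" where
  "locally_lipschitz g \<longleftrightarrow> local_lipschitz (UNIV :: real set) UNIV (\<lambda>_. g)"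

lemma locally_lipschitz_iff:
  "locally_lipschitz g \<longleftrightarrow> (\<forall>x. \<exists>u>0. \<exists>L. L-lipschitz_on (cball x u) g)"
  unfolding locally_lipschitz_def local_lipschitz_def Int_UNIV_right
  by (metis UNIV_I centre_in_cball less_imp_le)

definition Lip :: "(real \<Rightarrow> real) \<Rightarrow> real set \<Rightarrow> real" where
  "Lip u N = Sup {\<bar>u x - u y\<bar> / \<bar>x - y\<bar> | x y. x \<in> N \<and> y \<in> N \<and> x \<noteq> y}"

(* Meaningful for u Lipschitz on a bounded open interval N: then both suprema are taken over
   nonempty sets that are bounded above. *)
definition lip_norm :: "real set \<Rightarrow> (real \<Rightarrow> real) \<Rightarrow> real" where
  "lip_norm N u = max (SUP x\<in>closure N. \<bar>u x\<bar>) (Lip u N)"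

definition sink :: "(real \<Rightarrow> real) \<Rightarrow> real \<Rightarrow> bool" where
  "sink g q \<longleftrightarrow> g q = q \<and>
     (\<exists>\<epsilon>>0. \<forall>x\<in>nbhd \<epsilon> q. (\<lambda>k. (g ^^ k) x) \<longlonglongrightarrow> q)"

definition source :: "(real \<Rightarrow> real) \<Rightarrow> real \<Rightarrow> bool" where
  "source g q \<longleftrightarrow> g q = q \<and>
     (\<exists>\<epsilon>>0. \<forall>x\<in>nbhd \<epsilon> q. x \<noteq> q \<longrightarrow> (\<exists>k>0. \<bar>(g ^^ k) x - q\<bar> \<ge> \<epsilon>))"

end

theory Submission
  imports Defs
begin

text \<open>
  Since \<open>f\<close> is close to the linear map of slope \<open>C \<noteq> 1\<close> and \<open>f - g\<close> has a small Lipschitz constant,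
  the rescaled displacement \<open>x \<mapsto> (1 - C)\<inverse> (x - g x)\<close> differs from the identity by a map of Lipschitz
  constant at most \<open>1/2\<close> and is small at \<open>p\<close>. Hence it is strictly increasing and changes sign near
  \<open>p\<close>. The type of the fixed point is read off from the Lipschitz constant \<open>C + \<epsilon>\<close>, respectively the
  reverse Lipschitz constant \<open>r - \<epsilon>\<close>, of \<open>g\<close>.
\<close>

lemma lipschitz_on_bounded_image:
  fixes u :: "'a::heine_borel \<Rightarrow> 'b::heine_borel"
  assumes "L-lipschitz_on N u" and "bounded N"
  shows "bounded (u ` N)"
  using lipschitz_on_uniformly_continuous[OF assms(1)] assms(2)
  by (rule bounded_uniformly_continuous_image)

text \<open>Supplies a Lipschitz constant for \<open>g\<close>, hence one for \<open>f - g\<close>,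
  so that the suprema in \<open>lip_norm\<close> carry information.\<close>

lemma locally_lipschitz_imp_lipschitz_on_nbhd:
  assumes "locally_lipschitz g"
  obtains L where "L-lipschitz_on (nbhd \<delta> p) g"
proof -
  \<comment> \<open>Domain and dummy parameter set both shrink to compact sets: compactness turns
    the local bounds into one uniform bound.\<close>
  have "local_lipschitz {0::real} {p - \<delta>..p + \<delta>} (\<lambda>_. g)"
    using assms unfolding locally_lipschitz_def by (rule local_lipschitz_subset) auto
  then obtain L where "\<And>t. t \<in> {0::real} \<Longrightarrow> L-lipschitz_on {p - \<delta>..p + \<delta>} g"
    by (rule local_lipschitz_compact_implies_lipschitz) auto
  then have "L-lipschitz_on (nbhd \<delta> p) g"
    by (rule lipschitz_on_subset) auto
  then show thesis by (rule that)
qed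

text \<open>A supremum of reals dominates the members of its set only if that set is bounded above.
  The constant \<open>L\<close> guarantees this for both suprema; its size does not enter the
  conclusions.\<close>

lemma lip_norm_less_imp:
  fixes u :: "real \<Rightarrow> real"
  assumes "\<delta> > 0" and lip: "L-lipschitz_on (nbhd \<delta> p) u" and less: "lip_norm (nbhd \<delta> p) u < \<epsilon>"
  shows "\<And>x. x \<in> nbhd \<delta> p \<Longrightarrow> \<bar>u x\<bar> < \<epsilon>"
    and "\<And>x y. x \<in> nbhd \<delta> p \<Longrightarrow> y \<in> nbhd \<delta> p \<Longrightarrow> \<bar>u x - u y\<bar> \<le> \<epsilon> * \<bar>x - y\<bar>"
proof -
  let ?N = "nbhd \<delta> p"
  \<comment> \<open>The Lipschitz bound says nothing about \<open>u\<close> at the two endpoints,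
    but these add only finitely many values.\<close>
  have cl: "closure ?N = ?N \<union> {p - \<delta>, p + \<delta>}"
    using \<open>\<delta> > 0\<close> by auto
  have "bounded (u ` ?N)"
    using lip by (rule lipschitz_on_bounded_image) auto
  then have "bounded (u ` closure ?N)"
    unfolding cl image_Un by (auto intro: finite_imp_bounded)
  then have bdd: "bdd_above ((\<lambda>x. \<bar>u x\<bar>) ` closure ?N)"
    unfolding bounded_iff bdd_above_def by auto
  show "\<bar>u x\<bar> < \<epsilon>" if "x \<in> ?N" for x
  proof -
    have "\<bar>u x\<bar> \<le> (SUP x\<in>closure ?N. \<bar>u x\<bar>)"
      using that closure_subset by (intro cSUP_upper bdd) blast
    then show ?thesis using less unfolding lip_norm_def by linarith
  qed
  show "\<bar>u x - u y\<bar> \<le> \<epsilon> * \<bar>x - y\<bar>" if "x \<in> ?N" "y \<in> ?N" for x y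
  proof (cases "x = y")
    case False
    let ?Q = "{\<bar>u x - u y\<bar> / \<bar>x - y\<bar> | x y. x \<in> ?N \<and> y \<in> ?N \<and> x \<noteq> y}"
    have "bdd_above ?Q"
      using lipschitz_onD[OF lip]
      by (intro bdd_aboveI[of _ L]) (auto simp: dist_real_def divide_le_eq)
    then have "\<bar>u x - u y\<bar> / \<bar>x - y\<bar> \<le> Lip u ?N"
      unfolding Lip_def using that False by (intro cSup_upper) auto
    also have "\<dots> \<le> \<epsilon>"
      using less unfolding lip_norm_def by linarith
    finally show ?thesis using False by (simp add: divide_le_eq)
  qed simp
qed

lemma nbhd_contains_nbhd:
  fixes q :: real
  assumes "q \<in> nbhd \<delta> p"
  obtains \<eta> where "\<eta> > 0" and "nbhd \<eta> q \<subseteq> nbhd \<delta> p"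
proof
  show "min (q - (p - \<delta>)) (p + \<delta> - q) > 0" using assms by auto
  show "nbhd (min (q - (p - \<delta>)) (p + \<delta> - q)) q \<subseteq> nbhd \<delta> p" by auto
qed

text \<open>Since \<open>c ^ k\<close> is at most 1, iterates never leave the neighborhood, so the
  contraction towards \<open>q\<close> can be repeated and the distance to \<open>q\<close> decays
  geometrically.\<close>

lemma sink_if_contracting:
  assumes "g q = q" and "\<eta> > 0" and "0 \<le> c" and "c < 1"
    and contr: "\<And>x. x \<in> nbhd \<eta> q \<Longrightarrow> \<bar>g x - q\<bar> \<le> c * \<bar>x - q\<bar>"
  shows "sink g q"
  unfolding sink_def
proof (intro conjI exI[of _ \<eta>] ballI)
  fix x assume x: "x \<in> nbhd \<eta> q"
  have bound: "\<bar>(g ^^ k) x - q\<bar> \<le> c ^ k * \<bar>x - q\<bar>" for k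
  proof (induction k)
    case (Suc k)
    have "c ^ k * \<bar>x - q\<bar> \<le> 1 * \<bar>x - q\<bar>"
      using \<open>0 \<le> c\<close> \<open>c < 1\<close> by (intro mult_right_mono power_le_one) auto
    with Suc x have "(g ^^ k) x \<in> nbhd \<eta> q" by auto
    from contr[OF this] have "\<bar>(g ^^ Suc k) x - q\<bar> \<le> c * \<bar>(g ^^ k) x - q\<bar>" by simp
    also have "\<dots> \<le> c * (c ^ k * \<bar>x - q\<bar>)"
      using Suc \<open>0 \<le> c\<close> by (rule mult_left_mono)
    finally show ?case by (simp add: mult.assoc)
  qed simp
  have "(\<lambda>k. c ^ k * \<bar>x - q\<bar>) \<longlonglongrightarrow> 0"
    using \<open>0 \<le> c\<close> \<open>c < 1\<close> by (intro tendsto_mult_left_zero LIMSEQ_power_zero) auto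
  then have "(\<lambda>k. (g ^^ k) x - q) \<longlonglongrightarrow> 0"
    by (rule Lim_null_comparison[rotated]) (use bound in auto)
  then show "(\<lambda>k. (g ^^ k) x) \<longlonglongrightarrow> q"
    by (simp add: LIM_zero_iff)
qed (use assms in auto)

text \<open>As long as an orbit stays within \<eta> of \<open>q\<close>, its distance to
  \<open>q\<close> grows at least like \<open>c ^ k\<close>. An orbit that never left would thus
  violate the bound \<eta>.\<close>

lemma source_if_expanding:
  assumes "g q = q" and "\<eta> > 0" and "c > 1"
    and expand: "\<And>x. x \<in> nbhd \<eta> q \<Longrightarrow> c * \<bar>x - q\<bar> \<le> \<bar>g x - q\<bar>"
  shows "source g q"
  unfolding source_def
proof (intro conjI exI[of _ \<eta>] ballI impI)
  fix x assume x: "x \<in> nbhd \<eta> q" "x \<noteq> q"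
  show "\<exists>k>0. \<bar>(g ^^ k) x - q\<bar> \<ge> \<eta>"
  proof (rule ccontr)
    assume "\<not> (\<exists>k>0. \<bar>(g ^^ k) x - q\<bar> \<ge> \<eta>)"
    then have "\<bar>(g ^^ k) x - q\<bar> < \<eta>" if "k > 0" for k
      using that not_le by blast
    \<comment> \<open>The negated claim covers only positive \<open>k\<close>; the start of the
      orbit is added so that the induction can begin at 0.\<close>
    moreover have "\<bar>(g ^^ 0) x - q\<bar> < \<eta>"
      using x by (simp add: abs_less_iff)
    ultimately have close: "\<bar>(g ^^ k) x - q\<bar> < \<eta>" for k
      by (cases k) (blast intro: zero_less_Suc)+
    have bound: "c ^ k * \<bar>x - q\<bar> \<le> \<bar>(g ^^ k) x - q\<bar>" for k
    proof (induction k)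
      case (Suc k)
      have "c ^ Suc k * \<bar>x - q\<bar> \<le> c * \<bar>(g ^^ k) x - q\<bar>"
        using mult_left_mono[OF Suc, of c] \<open>c > 1\<close> by (simp add: mult.assoc)
      also have "\<dots> \<le> \<bar>(g ^^ Suc k) x - q\<bar>"
        using expand[of "(g ^^ k) x"] close[of k] by (simp add: abs_less_iff)
      finally show ?case .
    qed simp
    obtain k where "\<eta> / \<bar>x - q\<bar> < c ^ k"
      using real_arch_pow[OF \<open>c > 1\<close>] by blast
    then have "\<eta> < c ^ k * \<bar>x - q\<bar>"
      using x by (simp add: divide_less_eq)
    with bound[of k] close[of k] show False by linarith
  qed
qed (use assms in auto)

text \<open>Existence is the intermediate value theorem; two zeros at distance \<open>d\<close>
  would satisfy \<open>d \<le> d / 2\<close>.\<close>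

lemma unique_zero_if_near_identity:
  fixes \<phi> :: "real \<Rightarrow> real"
  assumes "\<delta> > 0" and cont: "continuous_on (nbhd \<delta> p) \<phi>" and small: "\<bar>\<phi> p\<bar> < \<delta> / 4"
    and near: "\<And>x y. x \<in> nbhd \<delta> p \<Longrightarrow> y \<in> nbhd \<delta> p \<Longrightarrow> \<bar>\<phi> x - \<phi> y - (x - y)\<bar> \<le> 1 / 2 * \<bar>x - y\<bar>"
  shows "\<exists>!q. q \<in> nbhd \<delta> p \<and> \<phi> q = 0"
proof (rule ex_ex1I)
  \<comment> \<open>Half the radius keeps the closed interval inside the open neighborhood. There
    the identity moves by \<delta>/2, which outweighs the error \<delta>/4 plus the value at
    \<open>p\<close>, below \<delta>/4.\<close>
  have "\<bar>\<phi> (p - \<delta> / 2) - \<phi> p + \<delta> / 2\<bar> \<le> \<delta> / 4" "\<bar>\<phi> (p + \<delta> / 2) - \<phi> p - \<delta> / 2\<bar> \<le> \<delta> / 4"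
    using near[of "p - \<delta> / 2" p] near[of "p + \<delta> / 2" p] \<open>\<delta> > 0\<close> by auto
  with small have "\<phi> (p - \<delta> / 2) \<le> 0" "0 \<le> \<phi> (p + \<delta> / 2)"
    by linarith+
  moreover have "continuous_on {p - \<delta> / 2..p + \<delta> / 2} \<phi>"
    using cont by (rule continuous_on_subset) (use \<open>\<delta> > 0\<close> in auto)
  ultimately obtain q where "p - \<delta> / 2 \<le> q" "q \<le> p + \<delta> / 2" "\<phi> q = 0"
    using IVT'[of \<phi> "p - \<delta> / 2" 0 "p + \<delta> / 2"] \<open>\<delta> > 0\<close> by auto
  then show "\<exists>q. q \<in> nbhd \<delta> p \<and> \<phi> q = 0"
    using \<open>\<delta> > 0\<close> by (intro exI[of _ q]) auto
next
  fix x y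
  assume "x \<in> nbhd \<delta> p \<and> \<phi> x = 0" "y \<in> nbhd \<delta> p \<and> \<phi> y = 0"
  then have "\<bar>x - y\<bar> \<le> 1 / 2 * \<bar>x - y\<bar>"
    using near[of x y] by (simp add: abs_minus_commute)
  then show "x = y" by simp
qed

text \<open>Dividing by \<open>1 - C\<close> treats \<open>C < 1\<close> and \<open>C > 1\<close>
  alike. The first bound on \<epsilon> makes the perturbation contribute 1/6, and 1/3 + 1/6 = 1/2;
  the second makes the displacement at \<open>p\<close> less than \<delta>/4.\<close>

lemma perturbed_fixed_point_unique:
  fixes f g :: "real \<Rightarrow> real"
  assumes "f p = p" and "\<delta> > 0" and "C \<noteq> 1" and cont: "continuous_on (nbhd \<delta> p) g"
    and lin: "\<And>x y. x \<in> nbhd \<delta> p \<Longrightarrow> y \<in> nbhd \<delta> p \<Longrightarrow>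
      \<bar>inverse (1 - C) * (f x - f y - C * (x - y))\<bar> \<le> 1 / 3 * \<bar>x - y\<bar>"
    and close: "\<bar>f p - g p\<bar> < \<epsilon>"
    and lip: "\<And>x y. x \<in> nbhd \<delta> p \<Longrightarrow> y \<in> nbhd \<delta> p \<Longrightarrow>
      \<bar>(f x - g x) - (f y - g y)\<bar> \<le> \<epsilon> * \<bar>x - y\<bar>"
    and eps: "\<epsilon> \<le> \<bar>1 - C\<bar> / 6" "\<epsilon> \<le> \<bar>1 - C\<bar> * \<delta> / 4"
  shows "\<exists>!q. q \<in> nbhd \<delta> p \<and> g q = q"
proof -
  define \<phi> where "\<phi> x = inverse (1 - C) * (x - g x)" for x
  have "\<exists>!q. q \<in> nbhd \<delta> p \<and> \<phi> q = 0"
  proof (rule unique_zero_if_near_identity[OF \<open>\<delta> > 0\<close>])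
    show "continuous_on (nbhd \<delta> p) \<phi>"
      unfolding \<phi>_def by (intro continuous_intros cont)
    have "\<bar>\<phi> p\<bar> = \<bar>f p - g p\<bar> / \<bar>1 - C\<bar>"
      using \<open>f p = p\<close> by (simp add: \<phi>_def abs_mult divide_inverse mult.commute)
    also have "\<dots> < \<delta> / 4"
      using close eps \<open>C \<noteq> 1\<close> by (simp add: divide_less_eq mult.commute)
    finally show "\<bar>\<phi> p\<bar> < \<delta> / 4" .
  next
    fix x y assume xy: "x \<in> nbhd \<delta> p" "y \<in> nbhd \<delta> p"
    \<comment> \<open>\<open>?A\<close> measures how far \<open>f\<close> is from slope
      \<open>C\<close>, \<open>?B\<close> how far \<open>g\<close> is from \<open>f\<close>.\<close>
    let ?A = "inverse (1 - C) * (f x - f y - C * (x - y))"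
    let ?B = "inverse (1 - C) * ((f x - g x) - (f y - g y))"
    have "x - y = inverse (1 - C) * ((1 - C) * (x - y))"
      using \<open>C \<noteq> 1\<close> by (simp add: mult.assoc[symmetric])
    then have "\<phi> x - \<phi> y - (x - y) =
        inverse (1 - C) * ((x - g x) - (y - g y) - (1 - C) * (x - y))"
      unfolding \<phi>_def right_diff_distrib by linarith
    also have "\<dots> = inverse (1 - C) * ((f x - g x) - (f y - g y) - (f x - f y - C * (x - y)))"
      by (simp add: algebra_simps)
    also have "\<dots> = ?B - ?A"
      by (rule right_diff_distrib)
    finally have "\<phi> x - \<phi> y - (x - y) = ?B - ?A" .
    moreover have "\<bar>?B\<bar> \<le> 1 / 6 * \<bar>x - y\<bar>"
    proof -
      have "\<bar>?B\<bar> = \<bar>(f x - g x) - (f y - g y)\<bar> / \<bar>1 - C\<bar>"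
        by (simp add: abs_mult divide_inverse mult.commute)
      also have "\<dots> \<le> (\<bar>1 - C\<bar> / 6 * \<bar>x - y\<bar>) / \<bar>1 - C\<bar>"
        using lip[OF xy] mult_right_mono[OF eps(1), of "\<bar>x - y\<bar>"]
        by (intro divide_right_mono) auto
      finally show ?thesis using \<open>C \<noteq> 1\<close> by simp
    qed
    ultimately show "\<bar>\<phi> x - \<phi> y - (x - y)\<bar> \<le> 1 / 2 * \<bar>x - y\<bar>"
      using lin[OF xy] by linarith
  qed
  moreover have "\<phi> q = 0 \<longleftrightarrow> g q = q" for q
    using \<open>C \<noteq> 1\<close> by (auto simp: \<phi>_def)
  ultimately show ?thesis by simp
qed

theorem theorem5p4:
  fixes f :: "real \<Rightarrow> real" and p \<delta> C :: real
  assumes "f p = p"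
    and "\<delta> > 0"
    and "C-lipschitz_on (nbhd \<delta> p) f"
    and "C \<noteq> 1"
    and "\<forall>x\<in>nbhd \<delta> p. \<forall>y\<in>nbhd \<delta> p.
           \<bar>inverse (1 - C) * (f x - f y - C * (x - y))\<bar> \<le> 1 / 3 * \<bar>x - y\<bar>"
  shows "\<exists>\<epsilon>\<^sub>0>0. \<forall>\<epsilon>. 0 < \<epsilon> \<and> \<epsilon> < \<epsilon>\<^sub>0 \<longrightarrow>
    (\<forall>g :: real \<Rightarrow> real.
       locally_lipschitz g \<and> lip_norm (nbhd \<delta> p) (\<lambda>x. f x - g x) < \<epsilon> \<longrightarrow>
       (\<exists>!q. q \<in> nbhd \<delta> p \<and> g q = q) \<and>
       (\<forall>q. q \<in> nbhd \<delta> p \<and> g q = q \<longrightarrow>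
          (C < 1 \<longrightarrow> sink g q) \<and>
          (\<forall>r>1. reverse_lipschitz_on r (nbhd \<delta> p) f \<longrightarrow> source g q)))"
proof -
  let ?N = "nbhd \<delta> p"
  \<comment> \<open>The threshold must not depend on \<open>r\<close>. As being a source does not mention \<open>r\<close>, one admissible
    constant \<open>s\<close> serves for all of them.\<close>
  obtain s :: real where "s > 1"
    and s: "\<And>r. r > 1 \<Longrightarrow> reverse_lipschitz_on r ?N f \<Longrightarrow> reverse_lipschitz_on s ?N f"
  proof (cases "\<exists>r>1. reverse_lipschitz_on r ?N f")
    case True
    then show ?thesis using that by blast
  next
    case False
    \<comment> \<open>The condition on \<open>s\<close> is vacuous here, so any number above 1
      serves.\<close>
    then show ?thesis using that[of 2] by auto
  qed
  \<comment> \<open>The first two entries give the unique fixed point, and the first also keeps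
    \<open>C + \<epsilon>\<close> below 1 when \<open>C < 1\<close>. The third keeps
    \<open>s - \<epsilon>\<close> above 1.\<close>
  define \<epsilon>\<^sub>0 where "\<epsilon>\<^sub>0 = Min {\<bar>1 - C\<bar> / 6, \<bar>1 - C\<bar> * \<delta> / 4, s - 1}"
  have "\<epsilon>\<^sub>0 > 0"
    using \<open>C \<noteq> 1\<close> \<open>\<delta> > 0\<close> \<open>s > 1\<close> by (simp add: \<epsilon>\<^sub>0_def)
  show ?thesis
  proof (intro exI conjI allI impI; (elim conjE)?)
    show "\<epsilon>\<^sub>0 > 0" by fact
    fix \<epsilon> and g :: "real \<Rightarrow> real"
    assume "0 < \<epsilon>" "\<epsilon> < \<epsilon>\<^sub>0" and g: "locally_lipschitz g"
      and norm: "lip_norm ?N (\<lambda>x. f x - g x) < \<epsilon>"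
    then have eps: "\<epsilon> < \<bar>1 - C\<bar> / 6" "\<epsilon> < \<bar>1 - C\<bar> * \<delta> / 4" "\<epsilon> < s - 1"
      by (auto simp: \<epsilon>\<^sub>0_def)
    obtain L where L: "L-lipschitz_on ?N g"
      using g by (rule locally_lipschitz_imp_lipschitz_on_nbhd)
    note diff = lip_norm_less_imp[OF \<open>\<delta> > 0\<close> lipschitz_on_diff[OF assms(3) L] norm]
    show "\<exists>!q. q \<in> ?N \<and> g q = q"
    proof (rule perturbed_fixed_point_unique[where f = f, OF assms(1,2,4) lipschitz_on_continuous_on[OF L]])
      show "\<bar>f p - g p\<bar> < \<epsilon>" using diff(1) \<open>\<delta> > 0\<close> by simp
    qed (use assms(5) diff(2) eps in auto)
    fix q assume q: "q \<in> ?N" "g q = q"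
    obtain \<eta> where "\<eta> > 0" and \<eta>: "nbhd \<eta> q \<subseteq> ?N"
      using q(1) by (rule nbhd_contains_nbhd)
    show "sink g q" if "C < 1"
    proof (rule sink_if_contracting[where g = g, OF q(2) \<open>\<eta> > 0\<close>])
      show "0 \<le> C + \<epsilon>" "C + \<epsilon> < 1"
        using lipschitz_on_nonneg[OF assms(3)] \<open>0 < \<epsilon>\<close> eps(1) that by auto
      fix x assume "x \<in> nbhd \<eta> q"
      then have x: "x \<in> ?N" using \<eta> by blast
      have "\<bar>f x - f q\<bar> \<le> C * \<bar>x - q\<bar>"
        using lipschitz_onD[OF assms(3) x q(1)] by (simp add: dist_real_def)
      with diff(2)[OF x q(1)] q(2) show "\<bar>g x - q\<bar> \<le> (C + \<epsilon>) * \<bar>x - q\<bar>"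
        unfolding distrib_right by linarith
    qed
    show "source g q" if "r > 1" "reverse_lipschitz_on r ?N f" for r
    proof (rule source_if_expanding[where g = g, OF q(2) \<open>\<eta> > 0\<close>])
      show "s - \<epsilon> > 1" using eps(3) by simp
      fix x assume "x \<in> nbhd \<eta> q"
      then have x: "x \<in> ?N" using \<eta> by blast
      have "s * \<bar>x - q\<bar> \<le> \<bar>f x - f q\<bar>"
        using s[OF that] x q(1) by (simp add: reverse_lipschitz_on_def)
      with diff(2)[OF x q(1)] q(2) show "(s - \<epsilon>) * \<bar>x - q\<bar> \<le> \<bar>g x - q\<bar>"
        unfolding left_diff_distrib by linarith
    qed
  qed
qed

end
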